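(* Let $d \geq 2$. For integers $1 \le k \le n$ and $m \ge 1$, let $\mathbf{I^d}(m,k,n)$ denote the maximum, over all sets $\mathcal{H}_R$ of $k$ red hyperplanes and $\mathcal{H}_B$ of $n-k$ blue hyperplanes in $\mathbb{E}^d$ (with $\mathcal{H}_R \cap \mathcal{H}_B = \emptyset$) and all sets $\mathcal{P}$ of $m$ vertices of the combined arrangement $\mathcal{H}_R \cup \mathcal{H}_B$, of the number of incident pairs $(P,H)$ with $P \in \mathcal{P}$, $H \in \mathcal{H}_R$. If $m = O(n^{d-2})$, then \[\mathbf{I^d}(m,k,n) = \Theta_d(mk).\]
   Context: A vertex of an arrangement of hyperplanes in $\mathbb{E}^d$ is a point that is the unique common point of some subset of the hyperplanes (i.e., a point that is the intersection of some of the hyperplanes, that intersection being a single point). The subscript $d$ in $\Theta_d$ indicates that the implied constants depend only on $d$ (and on the constant implicit in the hypothesis $m=O(n^{d-2})$). *)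

theory Defs
  imports "HOL-Analysis.Analysis"
begin

definition hyperplane :: "'a::euclidean_space set \<Rightarrow> bool" where
  "hyperplane H \<longleftrightarrow> (\<exists>a b. a \<noteq> 0 \<and> H = {x. a \<bullet> x = b})"

definition arrangement_vertex :: "'a::euclidean_space set set \<Rightarrow> 'a \<Rightarrow> bool" where
  "arrangement_vertex A p \<longleftrightarrow> (\<exists>S\<subseteq>A. \<Inter>S = {p})"

definition incidences :: "'a::euclidean_space set \<Rightarrow> 'a set set \<Rightarrow> nat" where
  "incidences P A = card {(p, H). p \<in> P \<and> H \<in> A \<and> p \<in> H}"

text \<open>\<open>R\<close> and \<open>B\<close> are the red and blue hyperplanes; the points of \<open>P\<close> are vertices of the
  combined arrangement, so they need not lie on any red hyperplane.\<close>

definition configuration ::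
  "nat \<Rightarrow> nat \<Rightarrow> nat \<Rightarrow> 'a::euclidean_space set set \<Rightarrow> 'a set set \<Rightarrow> 'a set \<Rightarrow> bool" where
  "configuration m k n R B P \<longleftrightarrow>
     (\<forall>H\<in>R \<union> B. hyperplane H) \<and> R \<inter> B = {} \<and>
     finite R \<and> card R = k \<and> finite B \<and> card B = n - k \<and>
     finite P \<and> card P = m \<and> (\<forall>p\<in>P. arrangement_vertex (R \<union> B) p)"

text \<open>The first argument only fixes the ambient space. The maximum is meaningful only if a
  configuration with these parameters exists: \<open>n\<close> hyperplanes may have fewer than \<open>m\<close> vertices.\<close>

definition max_incidences :: "'a::euclidean_space itself \<Rightarrow> nat \<Rightarrow> nat \<Rightarrow> nat \<Rightarrow> nat" where
  "max_incidences _ m k n =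
     Max {incidences P R | (R :: 'a set set) B P. configuration m k n R B P}"

end

(* The upper bound is the number of pairs. For the lower bound, half of the hyperplanes or more
   form a bundle through a common flat F of codimension 2, and the others are axis-parallel
   and cut out on F a grid of order n^(d-2) vertices. Colouring the bundle red first, each of
   these vertices lies on at least k/2 red hyperplanes. Off F the arrangement has order n^(d-1)
   further vertices, which pad the point set up to size m once n is large. For small n the
   product mk is bounded, and one incidence, obtained by recolouring, suffices. *)
theory Submission
  imports Defs
begin

section \<open>Choosing subsets of prescribed size and counting incidences\<close>

text \<open>Serves two greedy choices: red hyperplanes are taken from the bundle first, and points
  from the grid on the common flat first.\<close>

lemma obtain_subset_meeting:
  assumes "finite E" "X \<subseteq> E" "k \<le> card E"
  obtains R where "R \<subseteq> E" "card R = k" "min k (card X) \<le> card (R \<inter> X)"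
proof (cases "k \<le> card X")
  case True
  then obtain R where "R \<subseteq> X" "card R = k"
    using obtain_subset_with_card_n by metis
  then show ?thesis
    using that[of R] assms by (simp add: Int_absorb2)
next
  case False
  then obtain R where "X \<subseteq> R" "R \<subseteq> E" "card R = k"
    using exists_subset_between[of X k E] assms by auto
  then show ?thesis
    using that[of R] by (simp add: Int_absorb1)
qed

lemma incidences_ge:
  assumes "finite P" "finite A" "P' \<subseteq> P" "A' \<subseteq> A" "\<And>p H. p \<in> P' \<Longrightarrow> H \<in> A' \<Longrightarrow> p \<in> H"
  shows "card P' * card A' \<le> incidences P A"
proof -
  have "finite {(p, H). p \<in> P \<and> H \<in> A \<and> p \<in> H}"
    by (rule finite_subset[of _ "P \<times> A"]) (use assms in auto)
  moreover have "P' \<times> A' \<subseteq> {(p, H). p \<in> P \<and> H \<in> A \<and> p \<in> H}"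
    using assms by auto
  ultimately have "card (P' \<times> A') \<le> incidences P A"
    unfolding incidences_def by (rule card_mono)
  then show ?thesis
    by (simp add: card_cartesian_product)
qed

lemma incidences_le:
  assumes "finite P" "finite A"
  shows "incidences P A \<le> card P * card A"
proof -
  have "incidences P A \<le> card (P \<times> A)"
    unfolding incidences_def by (rule card_mono) (use assms in auto)
  then show ?thesis
    by (simp add: card_cartesian_product)
qed

section \<open>The maximum over all configurations\<close>

lemma configuration_incidences_le:
  "configuration m k n R B P \<Longrightarrow> incidences P R \<le> m * k"
  using incidences_le unfolding configuration_def by blast

text \<open>There may be infinitely many configurations, but their incidence counts are naturals
  bounded by \<open>m * k\<close>. This finiteness is what makes \<open>Max\<close> a genuine
  maximum.\<close>

lemma finite_configuration_incidences:
  "finite {incidences P R | (R :: 'a::euclidean_space set set) B P. configuration m k n R B P}"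
  by (rule finite_subset[of _ "{..m * k}"]) (auto dest: configuration_incidences_le)

lemma incidences_le_max_incidences:
  fixes R :: "'a::euclidean_space set set"
  assumes "configuration m k n R B P"
  shows "incidences P R \<le> max_incidences TYPE('a) m k n"
  unfolding max_incidences_def
  by (rule Max_ge[OF finite_configuration_incidences]) (use assms in blast)

text \<open>The given configuration makes the set of values nonempty, as the characterization of
  upper bounds of \<open>Max\<close> requires.\<close>

lemma max_incidences_le:
  fixes R :: "'a::euclidean_space set set"
  assumes "configuration m k n R B P"
  shows "max_incidences TYPE('a) m k n \<le> m * k"
  unfolding max_incidences_def
  by (subst Max_le_iff[OF finite_configuration_incidences])
    (use assms in \<open>auto dest: configuration_incidences_le\<close>)

text \<open>Being a vertex depends only on the union of the two colour classes, so any
  \<open>k\<close> hyperplanes of an arrangement may be declared red.\<close>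

lemma configuration_of_subset:
  assumes "finite E" "card E = n" "R \<subseteq> E" "card R = k" "\<And>H. H \<in> E \<Longrightarrow> hyperplane H"
    and "finite P" "card P = m" "\<And>p. p \<in> P \<Longrightarrow> arrangement_vertex E p"
  shows "configuration m k n R (E - R) P"
proof -
  have "R \<union> (E - R) = E"
    using assms(3) by blast
  with assms show ?thesis
    unfolding configuration_def by (auto simp: card_Diff_subset finite_subset)
qed

text \<open>The given red hyperplanes may miss every point of \<open>P\<close>. A vertex lies on
  some hyperplane of the arrangement, however, and recolouring makes that one red.\<close>

lemma max_incidences_pos:
  fixes R :: "'a::euclidean_space set set"
  assumes conf: "configuration m k n R B P" and "1 \<le> k" "k \<le> n" "1 \<le> m"
  shows "1 \<le> max_incidences TYPE('a) m k n"
proof -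
  define E where "E = R \<union> B"
  have fin: "finite E" "finite P" and hyp: "\<And>H. H \<in> E \<Longrightarrow> hyperplane H"
    and cards: "card P = m" and vert: "\<And>p. p \<in> P \<Longrightarrow> arrangement_vertex E p"
    using conf by (auto simp: configuration_def E_def)
  have cardE: "card E = n"
    using conf \<open>k \<le> n\<close> by (auto simp: configuration_def E_def card_Un_disjoint)
  obtain p where "p \<in> P"
    using cards \<open>1 \<le> m\<close> by fastforce
  then obtain S where S: "S \<subseteq> E" "\<Inter>S = {p}"
    using vert unfolding arrangement_vertex_def by blast
  \<comment> \<open>The empty family has intersection \<open>UNIV\<close>, which is not a single
    point because the space is infinite.\<close>
  have "infinite (UNIV :: 'a set)"
    using not_bounded_UNIV finite_imp_bounded by blast
  then have "S \<noteq> {}"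
    using S(2) by (metis Inter_empty finite.emptyI finite_insert)
  then obtain H where H: "H \<in> E" "p \<in> H"
    using S by blast
  obtain R' where R': "{H} \<subseteq> R'" "R' \<subseteq> E" "card R' = k"
    using exists_subset_between[of "{H}" k E] fin H cardE \<open>1 \<le> k\<close> \<open>k \<le> n\<close> by auto
  have "configuration m k n R' (E - R') P"
    using configuration_of_subset fin cardE R' hyp cards vert by metis
  moreover have "card {p} * card {H} \<le> incidences P R'"
    using H R' \<open>p \<in> P\<close> fin by (intro incidences_ge) (auto intro: finite_subset)
  ultimately show ?thesis
    using incidences_le_max_incidences[of m k n R' "E - R'" P] by simp
qed

section \<open>Vertices and grids of points\<close>

lemma arrangement_vertexI:
  assumes "\<And>y. (\<And>H. H \<in> A \<Longrightarrow> p \<in> H \<Longrightarrow> y \<in> H) \<Longrightarrow> y = p"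
  shows "arrangement_vertex A p"
  unfolding arrangement_vertex_def
  by (rule exI[of _ "{H \<in> A. p \<in> H}"]) (use assms in auto)

definition grid_points :: "nat \<Rightarrow> 'd set \<Rightarrow> (real ^ 'd) set" where
  "grid_points q S = {x. (\<forall>i\<in>S. x $ i \<in> real ` {1..q}) \<and> (\<forall>i. i \<notin> S \<longrightarrow> x $ i = 0)}"

lemma card_grid_points:
  fixes S :: "'d::finite set"
  shows "card (grid_points q S) = q ^ card S"
    and finite_grid_points: "finite (grid_points q S)"
proof -
  let ?F = "PiE S (\<lambda>_. {1..q})"
  let ?h = "\<lambda>f. \<chi> i. if i \<in> S then real (f i) else 0"
  have inj: "inj_on ?h ?F"
  proof (rule inj_onI)
    fix f g assume fg: "f \<in> ?F" "g \<in> ?F" "?h f = ?h g"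
    have "f i = g i" if "i \<in> S" for i
      using fg(3) that by (auto simp: vec_eq_iff dest: spec[of _ i])
    with fg(1,2) show "f = g"
      by (rule PiE_ext)
  qed
  have im: "grid_points q S = ?h ` ?F"
  proof (intro equalityI subsetI)
    fix x assume x: "x \<in> grid_points q S"
    \<comment> \<open>The floor recovers the integer coordinates, and restricting to
      \<open>S\<close> makes the function extensional, as membership in \<open>PiE\<close>
      demands.\<close>
    have "x = ?h (\<lambda>i\<in>S. nat \<lfloor>x $ i\<rfloor>)"
      using x by (auto simp: grid_points_def vec_eq_iff)
    moreover have "(\<lambda>i\<in>S. nat \<lfloor>x $ i\<rfloor>) \<in> ?F"
      using x by (fastforce simp: grid_points_def)
    ultimately show "x \<in> ?h ` ?F"
      by blast
  qed (auto simp: grid_points_def)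
  show "card (grid_points q S) = q ^ card S"
    unfolding im card_image[OF inj] by (simp add: card_PiE)
  show "finite (grid_points q S)"
    unfolding im by (intro finite_imageI finite_PiE) auto
qed

section \<open>Axis-parallel hyperplanes and the bundle through a flat\<close>

definition axis_plane :: "'d \<Rightarrow> real \<Rightarrow> (real ^ 'd) set" where
  "axis_plane i t = {x. x $ i = t}"

text \<open>For \<open>u \<noteq> v\<close> all these hyperplanes contain the flat of codimension 2
  on which the coordinates \<open>u\<close> and \<open>v\<close> vanish; \<open>s\<close> is a
  slope.\<close>

definition bundle_plane :: "'d \<Rightarrow> 'd \<Rightarrow> real \<Rightarrow> (real ^ 'd) set" where
  "bundle_plane u v s = {x. x $ u = s * x $ v}"

lemma hyperplane_axis_plane: "hyperplane (axis_plane i t :: (real ^ 'd::finite) set)"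
  unfolding hyperplane_def axis_plane_def
  by (intro exI[of _ "axis i 1"] exI[of _ t]) (auto simp: inner_axis' axis_eq_0_iff)

lemma hyperplane_bundle_plane:
  assumes "u \<noteq> v"
  shows "hyperplane (bundle_plane u v s :: (real ^ 'd::finite) set)"
proof -
  let ?a = "axis u 1 - s *\<^sub>R axis v 1 :: real ^ 'd"
  have "?a $ u = 1"
    using assms by (simp add: axis_def)
  then have "?a \<noteq> 0"
    by (metis zero_index zero_neq_one)
  moreover have "bundle_plane u v s = {x. ?a \<bullet> x = 0}"
    by (auto simp: bundle_plane_def inner_diff_left inner_axis')
  ultimately show ?thesis
    unfolding hyperplane_def by blast
qed

lemma axis_plane_eq_iff:
  "axis_plane (i :: 'd::finite) s = axis_plane j t \<longleftrightarrow> i = j \<and> s = t"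
proof
  assume eq: "axis_plane i s = axis_plane j t"
  \<comment> \<open>The value \<open>t + 1\<close> off coordinate \<open>i\<close> keeps this point
    out of \<open>axis_plane j t\<close> whenever \<open>j \<noteq> i\<close>.\<close>
  have "(\<chi> l. if l = i then s else t + 1) \<in> axis_plane i s"
    by (simp add: axis_plane_def)
  then show "i = j \<and> s = t"
    unfolding eq by (auto simp: axis_plane_def split: if_splits)
qed auto

lemma bundle_plane_eq_iff:
  assumes "u \<noteq> (v :: 'd::finite)"
  shows "bundle_plane u v s = bundle_plane u v t \<longleftrightarrow> s = t"
proof
  assume eq: "bundle_plane u v s = bundle_plane u v t"
  have "(\<chi> l. if l = u then s else 1) \<in> bundle_plane u v s"
    using assms by (simp add: bundle_plane_def)
  then show "s = t"
    unfolding eq using assms by (simp add: bundle_plane_def)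
qed auto

section \<open>The configuration with many incidences\<close>

lemma configuration_with_bundle:
  fixes u v :: "'d::finite"
  assumes "u \<noteq> v" "2 \<le> a" "n = (CARD('d) - 1) * q + a" "k \<le> n" "m \<le> q ^ (CARD('d) - 1)"
  obtains R B and P :: "(real ^ 'd) set"
  where "configuration m k n R B P" "min m (q ^ (CARD('d) - 2)) * min k a \<le> incidences P R"
proof -
  define X where "X = (\<lambda>j. bundle_plane u v (real j)) ` {..<a}"
  \<comment> \<open>The offsets start at 1, so these planes avoid the origin, which lies on every
    plane of \<open>X\<close>; hence \<open>X\<close> and \<open>Y\<close> are disjoint.\<close>
  define Y where "Y = (\<lambda>(i, t). axis_plane i (real t)) ` ((- {u}) \<times> {1..q})"
  define E where "E = X \<union> Y"
  \<comment> \<open>The first grid lies on the flat, hence on all \<open>a\<close> planes of the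
    bundle. The second lies in the bundle plane of slope 0 but off the flat, and supplies enough
    vertices to reach size \<open>m\<close>.\<close>
  define V where "V = grid_points q (- {u, v}) \<union> grid_points q (- {u})"
  have cards: "card (- {u}) = CARD('d) - 1" "card (- {u, v}) = CARD('d) - 2"
    using \<open>u \<noteq> v\<close> by (simp_all add: Compl_eq_Diff_UNIV card_Diff_subset)
  have finE: "finite X" "finite Y" "finite E"
    by (auto simp: X_def Y_def E_def)
  have cardX: "card X = a"
    unfolding X_def
    by (subst card_image) (auto intro!: inj_onI simp: bundle_plane_eq_iff[OF \<open>u \<noteq> v\<close>])
  have cardY: "card Y = (CARD('d) - 1) * q"
    unfolding Y_def
    by (subst card_image) (auto intro!: inj_onI simp: axis_plane_eq_iff card_cartesian_product cards)
  have "0 \<in> H" if "H \<in> X" for H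
    using that by (auto simp: X_def bundle_plane_def)
  moreover have "0 \<notin> H" if "H \<in> Y" for H
    using that by (auto simp: Y_def axis_plane_def)
  ultimately have "X \<inter> Y = {}"
    by blast
  then have cardE: "card E = n"
    using finE cardX cardY assms(3) by (simp add: E_def card_Un_disjoint)
  have hyp: "hyperplane H" if "H \<in> E" for H
    using that hyperplane_axis_plane hyperplane_bundle_plane[OF \<open>u \<noteq> v\<close>]
    by (auto simp: E_def X_def Y_def)
  have finV: "finite V"
    by (simp add: V_def finite_grid_points)
  have "card (grid_points q (- {u})) \<le> card V"
    by (rule card_mono[OF finV]) (simp add: V_def)
  then have "m \<le> card V"
    using assms(5) by (simp add: card_grid_points cards)
  \<comment> \<open>Slopes 0 and 1 both occur because \<open>2 \<le> a\<close>, and these two planes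
    already intersect in the flat.\<close>
  have bundle0: "bundle_plane u v 0 \<in> E"
    using \<open>2 \<le> a\<close> unfolding E_def X_def by (force intro: image_eqI[of _ _ 0])
  have bundle1: "bundle_plane u v 1 \<in> E"
    using \<open>2 \<le> a\<close> unfolding E_def X_def by (force intro: image_eqI[of _ _ 1])
  have axisE: "axis_plane i (x $ i) \<in> E" if "i \<noteq> u" "x $ i \<in> real ` {1..q}" for i and x :: "real ^ 'd"
    using that unfolding E_def Y_def by force
  have vert: "arrangement_vertex E x" if "x \<in> V" for x
  proof (rule arrangement_vertexI)
    fix y assume y: "\<And>H. H \<in> E \<Longrightarrow> x \<in> H \<Longrightarrow> y \<in> H"
    have xu: "x $ u = 0" and xi: "\<And>i. i \<noteq> u \<Longrightarrow> i \<noteq> v \<Longrightarrow> x $ i \<in> real ` {1..q}"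
      and xv: "x $ v \<in> real ` {1..q} \<or> x $ v = 0"
      using that \<open>u \<noteq> v\<close> by (auto simp: V_def grid_points_def)
    have yu: "y $ u = 0"
      using y[OF bundle0] xu by (simp add: bundle_plane_def)
    have eq: "y $ i = x $ i" if "i \<noteq> u" "x $ i \<in> real ` {1..q}" for i
      using y[OF axisE[OF that]] by (simp add: axis_plane_def)
    \<comment> \<open>On the flat no axis plane of \<open>Y\<close> fixes coordinate
      \<open>v\<close>, so the plane of slope 1 does; off the flat an axis plane in direction
      \<open>v\<close> passes through \<open>x\<close>.\<close>
    have "y $ v = x $ v"
    proof (cases "x $ v = 0")
      case True
      then show ?thesis
        using y[OF bundle1] xu yu by (simp add: bundle_plane_def)
    next
      case False
      then show ?thesis
        using eq[of v] xv \<open>u \<noteq> v\<close> by metis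
    qed
    then show "y = x"
      using eq xi xu yu by (metis vec_eq_iff)
  qed
  obtain R where R: "R \<subseteq> E" "card R = k" "min k (card X) \<le> card (R \<inter> X)"
    using obtain_subset_meeting[of E X k] finE cardE \<open>k \<le> n\<close> by (auto simp: E_def)
  obtain P where P: "P \<subseteq> V" "card P = m"
    "min m (card (grid_points q (- {u, v}))) \<le> card (P \<inter> grid_points q (- {u, v}))"
    using obtain_subset_meeting[OF finV _ \<open>m \<le> card V\<close>, of "grid_points q (- {u, v})"]
    by (auto simp: V_def)
  have finP: "finite P"
    using P(1) finV finite_subset by blast
  have "configuration m k n R (E - R) P"
    using configuration_of_subset[OF finE(3) cardE R(1,2) hyp finP P(2)] vert P(1) by blast
  moreover have "min m (q ^ (CARD('d) - 2)) * min k a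
      \<le> card (P \<inter> grid_points q (- {u, v})) * card (R \<inter> X)"
    using P(3) R(3) by (intro mult_le_mono) (simp_all add: card_grid_points cards cardX)
  moreover have "\<dots> \<le> incidences P R"
    using finP R(1) finE(3) finite_subset
    by (intro incidences_ge) (auto simp: grid_points_def X_def bundle_plane_def)
  ultimately show ?thesis
    using that by (meson le_trans)
qed

text \<open>The factor \<open>2 * K\<close> combines two losses: the bundle has at least
  \<open>n / 2\<close> planes, so \<open>min k a\<close> is at least \<open>k / 2\<close>, and
  \<open>m\<close> is at most \<open>K\<close> times the number of grid points on the flat.\<close>

lemma configuration_many_incidences:
  fixes C K :: real
  defines "d \<equiv> CARD('d::finite)"
  assumes "2 \<le> d" "0 < C" "1 \<le> K" "C * real (4 * d) ^ (d - 2) \<le> K"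
    and "real (4 * d) * K \<le> real n" "k \<le> n" "real m \<le> C * real n ^ (d - 2)"
  obtains R B and P :: "(real ^ 'd) set"
  where "configuration m k n R B P" "real m * real k \<le> 2 * K * real (incidences P R)"
proof -
  obtain u v :: 'd where "u \<noteq> v"
    using \<open>2 \<le> d\<close> unfolding d_def by (metis UNIV_I card_2_iff' ex_card)
  \<comment> \<open>The divisor \<open>2 * d\<close> lets the \<open>(d - 1) * q\<close> axis planes
    use at most half of the \<open>n\<close> hyperplanes.\<close>
  define q where "q = n div (2 * d)"
  have "d > 0"
    using \<open>2 \<le> d\<close> by simp
  have n_less: "n < 2 * d * (q + 1)"
    using \<open>d > 0\<close> dividend_less_times_div[of "2 * d" n] by (simp add: q_def algebra_simps)
  have "2 * d * q \<le> n"
    by (simp add: q_def)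
  have "real (4 * d) * K < 2 * real d * (real q + 1)"
    using assms(6) n_less by (metis (mono_tags) less_eq_real_def of_nat_1 of_nat_add of_nat_less_iff
      of_nat_mult of_nat_numeral order_le_less_trans)
  then have "2 * K < real q + 1"
    using \<open>d > 0\<close> by (simp add: mult.assoc)
  with \<open>1 \<le> K\<close> have "K \<le> real q" "1 \<le> q"
    by linarith+
  \<comment> \<open>Since \<open>1 \<le> q\<close>, rounding down costs at most a factor 2; this
    explains the \<open>4 * d\<close> in the condition on \<open>K\<close>.\<close>
  have "n \<le> 4 * d * q"
  proof -
    have "2 * d * (q + 1) \<le> 2 * d * (2 * q)"
      using \<open>1 \<le> q\<close> by (intro mult_le_mono) auto
    also have "2 * d * (2 * q) = 4 * d * q"
      by simp
    finally show ?thesis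
      using n_less by linarith
  qed
  have "2 * ((d - 1) * q) \<le> 2 * d * q"
    by simp
  define a where "a = n - (d - 1) * q"
  have n: "n = (d - 1) * q + a" and "n \<le> 2 * a"
    using order_trans[OF \<open>2 * ((d - 1) * q) \<le> 2 * d * q\<close> \<open>2 * d * q \<le> n\<close>] unfolding a_def by arith+
  have "d * 1 \<le> d * q"
    using \<open>1 \<le> q\<close> by (intro mult_le_mono) auto
  then have "2 \<le> a"
    using \<open>n \<le> 2 * a\<close> \<open>2 * d * q \<le> n\<close> \<open>2 \<le> d\<close> by linarith
  have "real m \<le> C * real n ^ (d - 2)"
    by fact
  also have "\<dots> \<le> C * real (4 * d * q) ^ (d - 2)"
    using \<open>n \<le> 4 * d * q\<close> \<open>0 < C\<close> by (intro mult_left_mono power_mono) (auto simp flip: of_nat_mult)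
  also have "\<dots> = (C * real (4 * d) ^ (d - 2)) * real q ^ (d - 2)"
    by (simp add: power_mult_distrib)
  also have "\<dots> \<le> K * real q ^ (d - 2)"
    using assms(5) by (intro mult_right_mono) auto
  finally have mK: "real m \<le> K * real q ^ (d - 2)" .
  \<comment> \<open>Largeness of \<open>n\<close> enters here through \<open>K \<le> real q\<close>:
    the grid one dimension higher has room for all \<open>m\<close> points.\<close>
  also have "\<dots> \<le> real q * real q ^ (d - 2)"
    using \<open>K \<le> real q\<close> by (intro mult_right_mono) auto
  also have "real q * real q ^ (d - 2) = real (q ^ (d - 1))"
  proof -
    have "Suc (d - 2) = d - 1"
      using \<open>2 \<le> d\<close> by simp
    then show ?thesis
      by (metis of_nat_power power_Suc)
  qed
  finally have mq: "m \<le> q ^ (d - 1)"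
    by (simp only: of_nat_le_iff)
  obtain R B and P :: "(real ^ 'd) set" where conf: "configuration m k n R B P"
    and inc: "min m (q ^ (d - 2)) * min k a \<le> incidences P R"
    using configuration_with_bundle[OF \<open>u \<noteq> v\<close> \<open>2 \<le> a\<close> n[unfolded d_def] \<open>k \<le> n\<close> mq[unfolded d_def]]
    unfolding d_def by blast
  \<comment> \<open>This covers the case in which the minimum is \<open>m\<close> itself.\<close>
  have "1 * real m \<le> K * real m"
    using \<open>1 \<le> K\<close> by (intro mult_right_mono) auto
  with mK have "real m \<le> K * real (min m (q ^ (d - 2)))"
    by (auto simp: min_def)
  moreover have "real k \<le> 2 * real (min k a)"
    using \<open>k \<le> n\<close> \<open>n \<le> 2 * a\<close> by (auto simp: min_def)
  ultimately have "real m * real k \<le> (K * real (min m (q ^ (d - 2)))) * (2 * real (min k a))"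
    using \<open>1 \<le> K\<close> by (intro mult_mono) auto
  also have "\<dots> = 2 * K * real (min m (q ^ (d - 2)) * min k a)"
    by (simp only: of_nat_mult mult_ac)
  also have "\<dots> \<le> 2 * K * real (incidences P R)"
    using inc \<open>1 \<le> K\<close> by (intro mult_left_mono) (auto simp only: of_nat_le_iff)
  finally show ?thesis
    using that conf by blast
qed

section \<open>The asymptotic bounds\<close>

text \<open>The bounds are stated for parameters that admit a configuration, since
  \<open>Max\<close> is unspecified on the empty set. The threshold \<open>N\<close> guarantees that
  for large \<open>n\<close> all parameters in the given range do.\<close>

theorem theorem1:
  fixes C :: real
  assumes "CARD('d::finite) \<ge> 2" and "C > 0"
  shows "\<exists>c\<^sub>1>0. \<exists>c\<^sub>2>0. \<exists>N. \<forall>m k n.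
           1 \<le> k \<and> k \<le> n \<and> 1 \<le> m \<and> real m \<le> C * real n ^ (CARD('d) - 2) \<longrightarrow>
           (n \<ge> N \<longrightarrow> (\<exists>R B (P :: (real ^ 'd) set). configuration m k n R B P)) \<and>
           ((\<exists>R B (P :: (real ^ 'd) set). configuration m k n R B P) \<longrightarrow>
              c\<^sub>1 * (real m * real k) \<le> real (max_incidences TYPE(real ^ 'd) m k n) \<and>
              real (max_incidences TYPE(real ^ 'd) m k n) \<le> c\<^sub>2 * (real m * real k))"
proof -
  define d where "d = CARD('d)"
  define K where "K = max 1 (C * real (4 * d) ^ (d - 2))"
  define N where "N = nat \<lceil>real (4 * d) * K\<rceil>"
  \<comment> \<open>The first summand is the loss for \<open>N \<le> n\<close>; the second bounds
    \<open>m * k\<close> for \<open>n < N\<close>, where a single incidence is enough.\<close>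
  define L where "L = 2 * K + C * real N ^ (d - 2) * real N"
  have "2 \<le> d" "1 \<le> K" "C * real (4 * d) ^ (d - 2) \<le> K"
    using assms by (auto simp: d_def K_def)
  have "2 * K \<le> L"
    using \<open>C > 0\<close> by (simp add: L_def)
  with \<open>1 \<le> K\<close> have "L > 0"
    by linarith
  have large: "\<exists>R B (P :: (real ^ 'd) set). configuration m k n R B P \<and>
      real m * real k \<le> 2 * K * real (incidences P R)"
    if "N \<le> n" "k \<le> n" "real m \<le> C * real n ^ (d - 2)" for m k n
  proof -
    have "real (4 * d) * K \<le> real n"
      using \<open>N \<le> n\<close> unfolding N_def by linarith
    then show ?thesis
      using configuration_many_incidences[where 'd = 'd, folded d_def, of C K n k m]
        \<open>2 \<le> d\<close> \<open>C > 0\<close> \<open>1 \<le> K\<close> \<open>C * real (4 * d) ^ (d - 2) \<le> K\<close> that by metis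
  qed
  have lower: "real m * real k \<le> L * real (max_incidences TYPE(real ^ 'd) m k n)"
    if conf: "configuration m k n R B P" and "1 \<le> k" "k \<le> n" "1 \<le> m"
      and m: "real m \<le> C * real n ^ (d - 2)" for m k n R B and P :: "(real ^ 'd) set"
  proof (cases "N \<le> n")
    case True
    then obtain R' B' and P' :: "(real ^ 'd) set" where conf': "configuration m k n R' B' P'"
      and inc: "real m * real k \<le> 2 * K * real (incidences P' R')"
      using large \<open>k \<le> n\<close> m by blast
    note inc
    also have "2 * K * real (incidences P' R') \<le> L * real (max_incidences TYPE(real ^ 'd) m k n)"
      using incidences_le_max_incidences[OF conf'] \<open>2 * K \<le> L\<close> \<open>L > 0\<close>
      by (intro mult_mono) auto
    finally show ?thesis .
  next
    case False
    have "C * real n ^ (d - 2) \<le> C * real N ^ (d - 2)"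
      using False \<open>C > 0\<close> by (intro mult_left_mono power_mono) auto
    with m have "real m \<le> C * real N ^ (d - 2)"
      by linarith
    then have "real m * real k \<le> (C * real N ^ (d - 2)) * real N"
      using False \<open>k \<le> n\<close> \<open>C > 0\<close> by (intro mult_mono) auto
    also have "\<dots> \<le> L * 1"
      using \<open>1 \<le> K\<close> by (simp add: L_def)
    also have "\<dots> \<le> L * real (max_incidences TYPE(real ^ 'd) m k n)"
      using max_incidences_pos[OF conf \<open>1 \<le> k\<close> \<open>k \<le> n\<close> \<open>1 \<le> m\<close>] \<open>L > 0\<close>
      by (intro mult_left_mono) auto
    finally show ?thesis .
  qed
  show ?thesis
  proof (rule exI[of _ "1 / L"], rule conjI, simp add: \<open>L > 0\<close>, rule exI[of _ "1 :: real"],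
      rule conjI, simp, rule exI[of _ N], intro allI impI conjI)
    fix m k n
    assume *: "1 \<le> k \<and> k \<le> n \<and> 1 \<le> m \<and> real m \<le> C * real n ^ (CARD('d) - 2)"
    show "\<exists>R B (P :: (real ^ 'd) set). configuration m k n R B P" if "N \<le> n"
      using large[OF that] * unfolding d_def by blast
    assume "\<exists>R B (P :: (real ^ 'd) set). configuration m k n R B P"
    then obtain R B and P :: "(real ^ 'd) set" where conf: "configuration m k n R B P"
      by blast
    show "1 / L * (real m * real k) \<le> real (max_incidences TYPE(real ^ 'd) m k n)"
      using lower[OF conf] * \<open>L > 0\<close> unfolding d_def by (simp add: field_simps)
    have "real (max_incidences TYPE(real ^ 'd) m k n) \<le> real (m * k)"
      using max_incidences_le[OF conf] by (simp only: of_nat_le_iff)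
    then show "real (max_incidences TYPE(real ^ 'd) m k n) \<le> 1 * (real m * real k)"
      by simp
  qed
qed

end
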